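(* Let $X$ be a treatment variable with $m$ values $x_1,\dots,x_m$ and $Y$ an effect variable with $n$ values $y_1,\dots,y_n$ in a structural causal model. Let $1\le i\le n$ and $1\le j\le m$. Then $$\max\{P(X=x_j,Y=y_i),\ P(Y_{x_j}=y_i)+P(Y=y_i)-1\}\ \le\ P(Y_{x_j}=y_i,\,Y=y_i)\ \le\ \min\{P(Y_{x_j}=y_i),\ P(Y=y_i)\}.$$
   Context: $Y_{x_j}$ denotes the counterfactual (potential outcome) variable "the value $Y$ would have, had $X$ been $x_j$". The structural causal model induces one probability space $P$ on which $X$, $Y$, and $Y_{x_1},\dots,Y_{x_m}$ (each with values in $\{y_1,\dots,y_n\}$) are jointly defined, and they satisfy consistency: on the event $X=x_j$ one has $Y_{x_j}=Y$ (so $P(Y_{x_j}=y_i,X=x_j)=P(X=x_j,Y=y_i)$). The values $x_1,\dots,x_m$ are distinct, as are $y_1,\dots,y_n$. *)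

theory Defs
  imports "HOL-Probability.Probability"
begin

text \<open>
  The joint distribution of a treatment \<open>X\<close>, an effect \<open>Y\<close> and the counterfactuals
  \<open>Y\<^sub>x\<close> induced by a structural causal model.  \<open>Ycf (x j)\<close> is the value \<open>Y\<close> would have,
  had \<open>X\<close> been \<open>x j\<close>; \<open>Ycf a\<close> is unconstrained when \<open>a\<close> is not one of the
  \<open>x j\<close>.  Measurability into \<^term>\<open>count_space A\<close> also says that all values lie in \<open>A\<close>.
\<close>

locale counterfactual_model = prob_space M
  for M :: "'w measure" +
  fixes m n :: nat
    and x :: "nat \<Rightarrow> 'a" and y :: "nat \<Rightarrow> 'b"
    and X :: "'w \<Rightarrow> 'a" and Y :: "'w \<Rightarrow> 'b"
    and Ycf :: "'a \<Rightarrow> 'w \<Rightarrow> 'b"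
  assumes x_distinct: "inj_on x {1..m}"
    and y_distinct: "inj_on y {1..n}"
    and X_measurable: "X \<in> measurable M (count_space (x ` {1..m}))"
    and Y_measurable: "Y \<in> measurable M (count_space (y ` {1..n}))"
    and Ycf_measurable:
      "\<And>j. j \<in> {1..m} \<Longrightarrow> Ycf (x j) \<in> measurable M (count_space (y ` {1..n}))"
    and consistency:
      "\<And>j \<omega>. j \<in> {1..m} \<Longrightarrow> \<omega> \<in> space M \<Longrightarrow> X \<omega> = x j \<Longrightarrow> Ycf (x j) \<omega> = Y \<omega>"

text \<open>
  Structural causal models, with the elements of \<open>'v\<close> as endogenous variables, \<open>'u\<close> as the
  type of exogenous states and \<open>'d\<close> as a common type of values, give rise to such a
  \<^locale>\<open>counterfactual_model\<close>: \<open>F v\<close> is the structural equation of \<open>v\<close>, and the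
  counterfactual is the solution for the effect variable after the equation of the treatment
  variable has been replaced by a constant.
\<close>

definition scm_solution ::
    "('v \<Rightarrow> 'u \<Rightarrow> ('v \<Rightarrow> 'd) \<Rightarrow> 'd) \<Rightarrow> 'u \<Rightarrow> ('v \<Rightarrow> 'd) \<Rightarrow> bool" where
  "scm_solution F u s \<longleftrightarrow> (\<forall>v. s v = F v u s)"

definition scm_value ::
    "('v \<Rightarrow> 'u \<Rightarrow> ('v \<Rightarrow> 'd) \<Rightarrow> 'd) \<Rightarrow> 'v \<Rightarrow> 'u \<Rightarrow> 'd" where
  "scm_value F v u = (THE s. scm_solution F u s) v"

definition scm_do ::
    "('v \<Rightarrow> 'u \<Rightarrow> ('v \<Rightarrow> 'd) \<Rightarrow> 'd) \<Rightarrow> 'v \<Rightarrow> 'd \<Rightarrow> ('v \<Rightarrow> 'u \<Rightarrow> ('v \<Rightarrow> 'd) \<Rightarrow> 'd)" where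
  "scm_do F t a = F(t := \<lambda>_ _. a)"

locale structural_causal_model = prob_space U
  for U :: "'u measure" +
  fixes F :: "'v \<Rightarrow> 'u \<Rightarrow> ('v \<Rightarrow> 'd) \<Rightarrow> 'd"
    and t e :: 'v
    and m n :: nat
    and x y :: "nat \<Rightarrow> 'd"
  assumes distinct_treatments: "inj_on x {1..m}"
    and distinct_effects: "inj_on y {1..n}"
    and solvable: "\<And>u. u \<in> space U \<Longrightarrow> \<exists>!s. scm_solution F u s"
    and do_solvable:
      "\<And>u j. u \<in> space U \<Longrightarrow> j \<in> {1..m} \<Longrightarrow> \<exists>!s. scm_solution (scm_do F t (x j)) u s"
    and treatment_measurable: "scm_value F t \<in> measurable U (count_space (x ` {1..m}))"
    and effect_measurable: "scm_value F e \<in> measurable U (count_space (y ` {1..n}))"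
    and counterfactual_measurable:
      "\<And>j. j \<in> {1..m} \<Longrightarrow>
        scm_value (scm_do F t (x j)) e \<in> measurable U (count_space (y ` {1..n}))"

sublocale structural_causal_model \<subseteq> counterfactual_model U m n x y
    "scm_value F t" "scm_value F e" "\<lambda>a. scm_value (scm_do F t a) e"
proof unfold_locales
  fix j u assume j: "j \<in> {1..m}" and u: "u \<in> space U" and t: "scm_value F t u = x j"
  define s where "s = (THE s. scm_solution F u s)"
  have s: "scm_solution F u s"
    unfolding s_def by (rule theI'[OF solvable[OF u]])
  have st: "s t = x j"
    using t by (simp add: scm_value_def s_def)
  have "scm_solution (scm_do F t (x j)) u s"
    using s st by (auto simp: scm_solution_def scm_do_def)
  then have "(THE s. scm_solution (scm_do F t (x j)) u s) = s"
    using do_solvable[OF u j] by (intro the1_equality)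
  then show "scm_value (scm_do F t (x j)) e u = scm_value F e u"
    by (simp add: scm_value_def s_def)
qed (fact distinct_treatments distinct_effects treatment_measurable effect_measurable
      counterfactual_measurable)+

end

theory Submission
  imports Defs
begin

text \<open>Write \<open>A\<close> for the event that the counterfactual under \<open>x j\<close>
  equals \<open>y i\<close>, and \<open>B\<close> for the event that \<open>Y\<close> does; the
  middle quantity is the probability of \<open>A \<inter> B\<close>. Consistency places the event of
  observing both \<open>x j\<close> and \<open>y i\<close> inside \<open>A \<inter> B\<close>, which
  gives the first lower bound. The second is the Fr\<e>chet-Bonferroni bound from
  inclusion-exclusion, and the upper bounds are monotonicity.\<close>

theorem theorem4:
  fixes M :: "'w measure"
    and m n i j :: nat
    and x :: "nat \<Rightarrow> 'a" and y :: "nat \<Rightarrow> 'b"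
    and X :: "'w \<Rightarrow> 'a" and Y :: "'w \<Rightarrow> 'b"
    and Ycf :: "'a \<Rightarrow> 'w \<Rightarrow> 'b"
  assumes "counterfactual_model M m n x y X Y Ycf"
    and "1 \<le> i" and "i \<le> n"
    and "1 \<le> j" and "j \<le> m"
  shows "max \<P>(\<omega> in M. X \<omega> = x j \<and> Y \<omega> = y i)
             (\<P>(\<omega> in M. Ycf (x j) \<omega> = y i) + \<P>(\<omega> in M. Y \<omega> = y i) - 1)
           \<le> \<P>(\<omega> in M. Ycf (x j) \<omega> = y i \<and> Y \<omega> = y i)
       \<and> \<P>(\<omega> in M. Ycf (x j) \<omega> = y i \<and> Y \<omega> = y i)
           \<le> min \<P>(\<omega> in M. Ycf (x j) \<omega> = y i) \<P>(\<omega> in M. Y \<omega> = y i)"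
proof -
  interpret counterfactual_model M m n x y X Y Ycf by fact
  have ij: "i \<in> {1..n}" "j \<in> {1..m}"
    using assms by auto
  define A where "A = {\<omega> \<in> space M. Ycf (x j) \<omega> = y i}"
  define B where "B = {\<omega> \<in> space M. Y \<omega> = y i}"
  \<comment> \<open>As \<open>i\<close> lies in \<open>{1..n}\<close>, the singleton of
    \<open>y i\<close> is measurable in the discrete space of effect values. The general
    \<open>f\<close> covers both \<open>Y\<close> and the counterfactual.\<close>
  have level_set: "{\<omega> \<in> space M. f \<omega> = y i} \<in> events"
    if "f \<in> measurable M (count_space (y ` {1..n}))" for f
  proof -
    have "f -` {y i} \<inter> space M \<in> events"
      using ij by (intro measurable_sets[OF that]) auto
    then show ?thesis
      by (simp add: vimage_def Int_def conj_commute)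
  qed
  have [measurable]: "A \<in> events" "B \<in> events"
    unfolding A_def B_def using level_set Ycf_measurable[OF ij(2)] Y_measurable by auto
  have AB: "{\<omega> \<in> space M. Ycf (x j) \<omega> = y i \<and> Y \<omega> = y i} = A \<inter> B"
    by (auto simp: A_def B_def)
  \<comment> \<open>Where \<open>X\<close> takes the value \<open>x j\<close>, consistency
    identifies the counterfactual with \<open>Y\<close>, so membership in \<open>B\<close> forces
    membership in \<open>A\<close>.\<close>
  have "{\<omega> \<in> space M. X \<omega> = x j \<and> Y \<omega> = y i} \<subseteq> A \<inter> B"
    using consistency[OF ij(2)] by (auto simp: A_def B_def)
  then have "\<P>(\<omega> in M. X \<omega> = x j \<and> Y \<omega> = y i) \<le> prob (A \<inter> B)"
    by (intro finite_measure_mono) auto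
  \<comment> \<open>Inclusion-exclusion, with the probability of the union bounded by 1.\<close>
  moreover have "prob A + prob B - 1 \<le> prob (A \<inter> B)"
    using measure_Un3[of A M B] prob_le_1[of "A \<union> B"] by (simp add: fmeasurable_eq_sets)
  moreover have "prob (A \<inter> B) \<le> prob A" "prob (A \<inter> B) \<le> prob B"
    by (auto intro: finite_measure_mono)
  ultimately show ?thesis
    unfolding AB by (simp add: A_def[symmetric] B_def[symmetric])
qed

end
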